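(* Let $\mathcal{Z}$ be a finite set, $E=\prod_{z\in\mathcal{Z}}(L_z,U_z)$ a product of $|\mathcal{Z}|$ intervals of the real line, and let $Q:E\to\mathbb{R}^{|\mathcal{Z}|}$ be a continuous function such that $\sum_{z\in\mathcal{Z}}Q_z(p)=c$ for all $p\in E$, for some constant $c\in\mathbb{R}$. Assume $Q$ satisfies weak substitutes and connected strict substitutes. Let $p$ and $p'$ be two vectors in $E$ such that there is $0\in\mathcal{Z}$ with $$Q_z(p)\le Q_z(p')\quad\text{for all } z\in\mathcal{Z}\setminus\{0\}.$$ Then: (i) $p_0\le p_0'$ implies $p_z\le p_z'$ for all $z\in\mathcal{Z}$; and (ii) $p_0<p_0'$ implies $p_z<p_z'$ for all $z\in\mathcal{Z}$.
   Context: Weak substitutes: for all $x\ne y$ in $\mathcal{Z}$, $Q_x(p)$ is nondecreasing in $p_x$ and nonincreasing in $p_y$. Connected strict substitutes: for every nonempty set $\mathcal{X}\subset\mathcal{Z}$ and all $p,p'\in E$, if $p_x=p'_x$ for $x\in\mathcal{X}$, $p_y\le p'_y$ for $y\notin\mathcal{X}$, and $p\ne p'$, then $\sum_{x\in\mathcal{X}}Q_x(p)>\sum_{x\in\mathcal{X}}Q_x(p')$. *)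

theory Defs
  imports "HOL-Analysis.Analysis"
begin

text \<open>
  The finite index set is the finite type \<open>'z\<close>. Interval endpoints are extended reals, so
  bounded intervals, half-lines and the whole real line are all covered.
\<close>

definition price_box :: "('z::finite \<Rightarrow> ereal) \<Rightarrow> ('z \<Rightarrow> ereal) \<Rightarrow> (real ^ 'z) set" where
  "price_box L U = {p. \<forall>z. ereal (p $ z) \<in> {L z<..<U z}}"

definition nondecreasing_in :: "'z \<Rightarrow> (real ^ 'z::finite) set \<Rightarrow> (real ^ 'z \<Rightarrow> real) \<Rightarrow> bool" where
  "nondecreasing_in i E f \<longleftrightarrow>
     (\<forall>p\<in>E. \<forall>p'\<in>E. (\<forall>j. j \<noteq> i \<longrightarrow> p $ j = p' $ j) \<and> p $ i \<le> p' $ i \<longrightarrow> f p \<le> f p')"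

definition nonincreasing_in :: "'z \<Rightarrow> (real ^ 'z::finite) set \<Rightarrow> (real ^ 'z \<Rightarrow> real) \<Rightarrow> bool" where
  "nonincreasing_in i E f \<longleftrightarrow>
     (\<forall>p\<in>E. \<forall>p'\<in>E. (\<forall>j. j \<noteq> i \<longrightarrow> p $ j = p' $ j) \<and> p $ i \<le> p' $ i \<longrightarrow> f p' \<le> f p)"

definition weak_substitutes :: "(real ^ 'z::finite) set \<Rightarrow> (real ^ 'z \<Rightarrow> real ^ 'z) \<Rightarrow> bool" where
  "weak_substitutes E Q \<longleftrightarrow>
     (\<forall>x y. x \<noteq> y \<longrightarrow>
        nondecreasing_in x E (\<lambda>p. Q p $ x) \<and> nonincreasing_in y E (\<lambda>p. Q p $ x))"

text \<open>
  Below, \<open>X = UNIV\<close> is harmless: the hypotheses would force \<open>p = p'\<close>. So it does not matter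
  whether \<open>X\<close> ranges over all subsets or only over proper ones.
\<close>

definition connected_strict_substitutes ::
    "(real ^ 'z::finite) set \<Rightarrow> (real ^ 'z \<Rightarrow> real ^ 'z) \<Rightarrow> bool" where
  "connected_strict_substitutes E Q \<longleftrightarrow>
     (\<forall>X. X \<noteq> {} \<longrightarrow>
        (\<forall>p\<in>E. \<forall>p'\<in>E.
           (\<forall>x\<in>X. p $ x = p' $ x) \<and> (\<forall>y. y \<notin> X \<longrightarrow> p $ y \<le> p' $ y) \<and> p \<noteq> p' \<longrightarrow>
           (\<Sum>x\<in>X. Q p $ x) > (\<Sum>x\<in>X. Q p' $ x)))"

end

theory Submission
  imports Defs
begin

text \<open>
  Let \<open>q\<close> be the componentwise maximum of \<open>p\<close> and \<open>p'\<close>, and \<open>Y\<close> the set where \<open>p\<close> exceeds \<open>p'\<close>.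
  Going from \<open>p'\<close> to \<open>q\<close> raises only the components in \<open>Y\<close>, which strictly lowers the total of \<open>Q\<close>
  off \<open>Y\<close> and hence, the overall total being constant, strictly raises it on \<open>Y\<close>. Going from \<open>q\<close>
  down to \<open>p\<close> lowers only components off \<open>Y\<close>, which does not lower the total on \<open>Y\<close>. So \<open>Q p\<close>
  has a strictly larger total on \<open>Y\<close> than \<open>Q p'\<close>, although \<open>Q p \<le> Q p'\<close> there.
\<close>

lemma max_mem_price_box:
  assumes "p \<in> price_box L U" "p' \<in> price_box L U"
  shows "(\<chi> z. max (p $ z) (p' $ z)) \<in> price_box L U"
  using assms by (auto simp: price_box_def max_def)

lemma connected_strict_substitutesD:
  assumes "connected_strict_substitutes E Q" "X \<noteq> {}" "p \<in> E" "p' \<in> E"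
    and "\<And>x. x \<in> X \<Longrightarrow> p $ x = p' $ x" "\<And>y. y \<notin> X \<Longrightarrow> p $ y \<le> p' $ y" "p \<noteq> p'"
  shows "(\<Sum>x\<in>X. Q p' $ x) < (\<Sum>x\<in>X. Q p $ x)"
  using assms unfolding connected_strict_substitutes_def by blast

theorem theorem2:
  fixes L U :: "'z::finite \<Rightarrow> ereal"
    and E :: "(real ^ 'z) set"
    and Q :: "real ^ 'z \<Rightarrow> real ^ 'z"
    and c :: real
    and p p' :: "real ^ 'z"
    and z\<^sub>0 :: 'z
  assumes E: "E = price_box L U"
    and cont: "continuous_on E Q"
    and const: "\<And>q. q \<in> E \<Longrightarrow> (\<Sum>z\<in>UNIV. Q q $ z) = c"
    and weak: "weak_substitutes E Q"
    and strict: "connected_strict_substitutes E Q"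
    and p: "p \<in> E"
    and p': "p' \<in> E"
    and le: "\<And>z. z \<noteq> z\<^sub>0 \<Longrightarrow> Q p $ z \<le> Q p' $ z"
  shows "(p $ z\<^sub>0 \<le> p' $ z\<^sub>0 \<longrightarrow> (\<forall>z. p $ z \<le> p' $ z)) \<and>
         (p $ z\<^sub>0 < p' $ z\<^sub>0 \<longrightarrow> (\<forall>z. p $ z < p' $ z))"
proof -
  have mono: "\<forall>z. p $ z \<le> p' $ z" if "p $ z\<^sub>0 \<le> p' $ z\<^sub>0"
  proof (rule ccontr)
    define Y where "Y = {z. p' $ z < p $ z}"
    define q where "q = (\<chi> z. max (p $ z) (p' $ z))"
    assume "\<not> ?thesis"
    then have "Y \<noteq> {}"
      by (auto simp: Y_def not_le)
    \<comment> \<open>This serves twice: it makes \<open>-Y\<close> nonempty, as strict substitutes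
      demands, and it lets \<open>le\<close> apply on all of \<open>Y\<close>.\<close>
    have "z\<^sub>0 \<notin> Y"
      using that by (simp add: Y_def)
    have "q \<in> E"
      unfolding E q_def using p p' by (intro max_mem_price_box) (simp_all add: E)
    have split: "(\<Sum>z\<in>Y. Q r $ z) + (\<Sum>z\<in>-Y. Q r $ z) = c" if "r \<in> E" for r
      using const[OF that] sum.subset_diff[of Y UNIV "\<lambda>z. Q r $ z"]
      by (simp add: Compl_eq_Diff_UNIV)
    have "(\<Sum>z\<in>-Y. Q q $ z) < (\<Sum>z\<in>-Y. Q p' $ z)"
    proof (rule connected_strict_substitutesD[OF strict _ p' \<open>q \<in> E\<close>])
      show "p' \<noteq> q"
        using \<open>Y \<noteq> {}\<close> by (auto simp: Y_def q_def vec_eq_iff max_def not_le)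
    qed (use \<open>z\<^sub>0 \<notin> Y\<close> in \<open>auto simp: Y_def q_def max_def\<close>)
    then have "(\<Sum>z\<in>Y. Q p' $ z) < (\<Sum>z\<in>Y. Q q $ z)"
      using split[OF p'] split[OF \<open>q \<in> E\<close>] by linarith
    also have "\<dots> \<le> (\<Sum>z\<in>Y. Q p $ z)"
    \<comment> \<open>Strict substitutes compares distinct vectors only, and \<open>p = q\<close>
      occurs when \<open>p\<close> dominates \<open>p'\<close> everywhere.\<close>
    proof (cases "p = q")
      case False
      show ?thesis
        by (rule less_imp_le, rule connected_strict_substitutesD[OF strict \<open>Y \<noteq> {}\<close> p \<open>q \<in> E\<close> _ _ False])
          (auto simp: Y_def q_def max_def)
    qed simp
    also have "\<dots> \<le> (\<Sum>z\<in>Y. Q p' $ z)"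
      using le \<open>z\<^sub>0 \<notin> Y\<close> by (intro sum_mono) metis
    finally show False
      by simp
  qed
  have "\<forall>z. p $ z < p' $ z" if less: "p $ z\<^sub>0 < p' $ z\<^sub>0"
  proof (rule ccontr)
    \<comment> \<open>By \<open>mono\<close>, strictness can fail only at a tie. Moving from
      \<open>p\<close> to \<open>p'\<close> fixes the ties and raises the other components, so the
      total of \<open>Q\<close> on \<open>X\<close> drops strictly, against
      \<open>le\<close>.\<close>
    define X where "X = {z. p $ z = p' $ z}"
    have le': "p $ z \<le> p' $ z" for z
      using mono less by simp
    assume "\<not> ?thesis"
    then have "X \<noteq> {}"
      using le' by (force simp: X_def not_less intro: antisym)
    then have "(\<Sum>z\<in>X. Q p' $ z) < (\<Sum>z\<in>X. Q p $ z)"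
      using less le' by (intro connected_strict_substitutesD[OF strict _ p p']) (auto simp: X_def)
    moreover have "z\<^sub>0 \<notin> X"
      using less by (simp add: X_def)
    then have "(\<Sum>z\<in>X. Q p $ z) \<le> (\<Sum>z\<in>X. Q p' $ z)"
      using le by (intro sum_mono) metis
    ultimately show False
      by simp
  qed
  with mono show ?thesis
    by blast
qed

end
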